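(* Let $G$ be an abelian group and $\mathbb{K}$ an algebraically closed field of characteristic zero. If $D$ is a $G$-graded division algebra over $\mathbb{K}$ that satisfies an ordinary polynomial identity, then there exists a natural number $t$ such that $D$ satisfies the same ordinary identities as $M_t(\mathbb{K})$.
   Context: A $G$-grading on an algebra $D$ is a vector space decomposition $D=\bigoplus_{g\in G}D_g$ with $D_gD_h\subseteq D_{gh}$. $D$ is a graded division algebra if it has a unit and every nonzero homogeneous element (element of some $D_g$) is invertible. An ordinary identity of an algebra is a polynomial in the free associative algebra over $\mathbb{K}$ that vanishes under all substitutions of its variables by elements of the algebra; "satisfies an ordinary polynomial identity" means that some nonzero such polynomial exists. *)

theory Defs
  imports
    "HOL-Library.Poly_Mapping"
    "HOL-Algebra.Algebraic_Closure_Type"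
    "Jordan_Normal_Form.Matrix"
begin

text \<open>
  Unital associative algebras over a field. As \<open>ring_1\<close> includes \<open>0 \<noteq> 1\<close>, the zero algebra
  is excluded.
\<close>

locale unital_algebra = vector_space scale
  for scale :: "'k::field \<Rightarrow> 'd::ring_1 \<Rightarrow> 'd" +
  assumes scale_mult_left: "scale a x * y = scale a (x * y)"
    and scale_mult_right: "x * scale a y = scale a (x * y)"

text \<open>The abelian grading group is written additively.\<close>

locale graded_algebra = unital_algebra scale
  for scale :: "'k::field \<Rightarrow> 'd::ring_1 \<Rightarrow> 'd" +
  fixes component :: "'g::ab_group_add \<Rightarrow> 'd set"
  assumes subspace_component: "subspace (component g)"
    and direct_sum:
      "\<exists>!d. (\<forall>g. d g \<in> component g) \<and> finite {g. d g \<noteq> 0} \<and> x = (\<Sum>g | d g \<noteq> 0. d g)"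
    and component_mult:
      "x \<in> component g \<Longrightarrow> y \<in> component h \<Longrightarrow> x * y \<in> component (g + h)"

locale graded_division_algebra = graded_algebra scale component
  for scale :: "'k::field \<Rightarrow> 'd::ring_1 \<Rightarrow> 'd"
    and component :: "'g::ab_group_add \<Rightarrow> 'd set" +
  assumes homogeneous_invertible:
    "x \<in> component g \<Longrightarrow> x \<noteq> 0 \<Longrightarrow> \<exists>y. x * y = 1 \<and> y * x = 1"

text \<open>
  The free associative algebra on the variables \<open>x\<^sub>0, x\<^sub>1, \<dots>\<close>: finitely supported
  coefficient functions on the words in the variable indices, the word \<open>[i\<^sub>1, \<dots>, i\<^sub>m]\<close> standing
  for the noncommutative monomial \<open>x\<^bsub>i\<^sub>1\<^esub> \<cdots> x\<^bsub>i\<^sub>m\<^esub>\<close> and \<open>[]\<close> for \<open>1\<close>.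
\<close>

type_synonym 'k free_algebra = "nat list \<Rightarrow>\<^sub>0 'k"

text \<open>
  An algebra is given here by a ring record together with its scalar multiplication, so that
  algebras living on a whole type and matrix algebras of varying size are treated alike.
\<close>

definition eval_word :: "('a, 'm) ring_scheme \<Rightarrow> (nat \<Rightarrow> 'a) \<Rightarrow> nat list \<Rightarrow> 'a" where
  "eval_word A \<sigma> w = foldr (\<lambda>i y. \<sigma> i \<otimes>\<^bsub>A\<^esub> y) w \<one>\<^bsub>A\<^esub>"

definition eval_free ::
  "('a, 'm) ring_scheme \<Rightarrow> ('k::zero \<Rightarrow> 'a \<Rightarrow> 'a) \<Rightarrow> (nat \<Rightarrow> 'a) \<Rightarrow> 'k free_algebra \<Rightarrow> 'a" where
  "eval_free A scale \<sigma> f =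
     (\<Oplus>\<^bsub>A\<^esub>w\<in>Poly_Mapping.keys f. scale (Poly_Mapping.lookup f w) (eval_word A \<sigma> w))"

definition ordinary_identities ::
  "('a, 'm) ring_scheme \<Rightarrow> ('k::zero \<Rightarrow> 'a \<Rightarrow> 'a) \<Rightarrow> 'k free_algebra set" where
  "ordinary_identities A scale =
     {f. \<forall>\<sigma>. (\<forall>i. \<sigma> i \<in> carrier A) \<longrightarrow> eval_free A scale \<sigma> f = \<zero>\<^bsub>A\<^esub>}"

end

theory Submission
  imports Defs "HOL-Library.Sublist"
begin

text \<open>
  This is a graded version of Kaplansky's theorem on primitive PI algebras. Let \<open>C\<close> be a maximal
  set of pairwise commuting homogeneous elements of \<open>D\<close>, and consider the operators
  \<open>x \<mapsto> \<Sum> a x c\<close> with \<open>a \<in> D\<close>, \<open>c \<in> C\<close>. Suppose homogeneous elements \<open>v\<^sub>i\<close> and homogeneous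
  operators \<open>e\<^sub>i\<close> satisfy \<open>e\<^sub>i v\<^sub>j = \<delta>\<^sub>i\<^sub>j\<close>. The operators \<open>v\<^sub>i e\<^sub>j\<close> act on the \<open>v\<^sub>l\<close> as
  matrix units and the \<open>c\<close> commute, so \<open>M\<^sub>n(K)\<close> satisfies all identities of \<open>D\<close>; as a
  nonzero polynomial is not an identity of large matrices, \<open>n\<close> is bounded. If \<open>n\<close> cannot be
  increased, every homogeneous operator killing all \<open>v\<^sub>i\<close> is zero. Applied to
  \<open>x \<mapsto> x - \<Sum> v\<^sub>i e\<^sub>i x\<close> and to \<open>x \<mapsto> (e\<^sub>i x) c - c (e\<^sub>i x)\<close>, this gives \<open>x = \<Sum> v\<^sub>i e\<^sub>i x\<close> and,
  by maximality of \<open>C\<close>, that the values of the \<open>e\<^sub>i\<close> commute. Hence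
  \<open>d \<mapsto> (e\<^sub>i (d v\<^sub>j))\<close> represents \<open>D\<close> faithfully by matrices over a commutative algebra, and
  \<open>D\<close> satisfies the identities of \<open>M\<^sub>n(K)\<close>.
\<close>

section \<open>Polynomial dependence on scalars\<close>

text \<open>Dedekind's independence of characters, for the multiplicative functions \<open>t \<mapsto> t\<^sup>\<mu>\<close>.\<close>

lemma monomials_independent:
  fixes scale :: "'k::field_char_0 \<Rightarrow> 'v::ab_group_add \<Rightarrow> 'v" and c :: "'x multiset \<Rightarrow> 'v"
  assumes "vector_space scale" and "finite M"
    and "\<And>t. (\<Sum>\<mu>\<in>M. scale (\<Prod>x\<in>#\<mu>. t x) (c \<mu>)) = 0" and "\<mu> \<in> M"
  shows "c \<mu> = 0"
  using assms(2-)
proof (induction M arbitrary: c \<mu>)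
  case empty
  then show ?case by simp
next
  case (insert \<nu> M)
  interpret vector_space scale by fact
  let ?m = "\<lambda>t (\<mu> :: 'x multiset). \<Prod>x\<in>#\<mu>. t x :: 'k"
  have M0: "c \<mu> = 0" if "\<mu> \<in> M" for \<mu>
  proof -
    have "\<mu> \<noteq> \<nu>" using that insert by auto
    then obtain x where x: "count \<mu> x \<noteq> count \<nu> x" by (metis multiset_eqI)
    \<comment> \<open>Only the variable \<open>x\<close>, whose exponents in \<open>\<mu>\<close>
      and \<open>\<nu>\<close> differ, is rescaled. This multiplies the monomial of
      \<open>\<kappa>\<close> by \<open>2 ^ count \<kappa> x\<close>.\<close>
    define u where "u y = (if y = x then 2 else 1 :: 'k)" for y
    have u: "?m u \<kappa> = 2 ^ count \<kappa> x" for \<kappa>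
      by (induction \<kappa>) (auto simp: u_def)
    have tu: "?m (\<lambda>y. t y * u y) \<kappa> = ?m t \<kappa> * 2 ^ count \<kappa> x" for t \<kappa>
      by (simp add: prod_mset.distrib u)
    have "(\<Sum>\<kappa>\<in>M. scale (?m t \<kappa>) (scale (2 ^ count \<nu> x - 2 ^ count \<kappa> x) (c \<kappa>))) = 0" for t
    proof -
      \<comment> \<open>Both sums vanish; in their difference the term of \<open>\<nu>\<close>
        cancels, which leaves a relation over the smaller set \<open>M\<close>.\<close>
      have "scale (2 ^ count \<nu> x) (\<Sum>\<kappa>\<in>insert \<nu> M. scale (?m t \<kappa>) (c \<kappa>))
          - (\<Sum>\<kappa>\<in>insert \<nu> M. scale (?m (\<lambda>y. t y * u y) \<kappa>) (c \<kappa>)) = 0"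
        using insert.prems(1) by simp
      then have "(\<Sum>\<kappa>\<in>insert \<nu> M. scale (?m t \<kappa>) (scale (2 ^ count \<nu> x - 2 ^ count \<kappa> x) (c \<kappa>))) = 0"
        unfolding tu scale_sum_right sum_subtractf[symmetric]
        by (simp add: scale_left_diff_distrib scale_right_diff_distrib mult.commute del: sum.insert)
      then show ?thesis using insert.hyps by simp
    qed
    from insert.IH[OF this that] have "scale (2 ^ count \<nu> x - 2 ^ count \<mu> x) (c \<mu>) = 0" .
    moreover have "(2 :: 'k) ^ a \<noteq> 2 ^ b" if "a \<noteq> b" for a b :: nat
    proof
      assume "(2 :: 'k) ^ a = 2 ^ b"
      then have "(of_nat (2 ^ a) :: 'k) = of_nat (2 ^ b)" by simp
      then have "(2 :: nat) ^ a = 2 ^ b" by (simp only: of_nat_eq_iff)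
      then show False using that by simp
    qed
    ultimately show ?thesis using x by auto
  qed
  have "c \<nu> = 0" using insert.prems(1)[of "\<lambda>_. 1"] insert.hyps M0 by simp
  then show ?case using M0 insert.prems by auto
qed

text \<open>
  Scalar parameters in an identity may be replaced by commuting elements of a larger algebra; this
  takes the place of multilinearization.
\<close>

lemma polynomial_identity_transfer:
  fixes scale :: "'k::field_char_0 \<Rightarrow> 'v::ab_group_add \<Rightarrow> 'v"
    and \<mu> :: "'w \<Rightarrow> 'q \<Rightarrow> 'x multiset" and \<Phi> :: "'x multiset \<Rightarrow> 'v \<Rightarrow> 'u::ab_group_add"
  assumes "vector_space scale" and fin: "finite W"
    and vanish: "\<And>t. (\<Sum>w\<in>W. \<Sum>q\<leftarrow>Q w. scale (\<Prod>x\<in>#\<mu> w q. t x) (b w q)) = 0"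
    and add: "\<And>\<nu> x y. \<Phi> \<nu> (x + y) = \<Phi> \<nu> x + \<Phi> \<nu> y"
  shows "(\<Sum>w\<in>W. \<Sum>q\<leftarrow>Q w. \<Phi> (\<mu> w q) (b w q)) = 0"
proof -
  interpret vector_space scale by fact
  define J where "J = (SIGMA w:W. {0..<length (Q w)})"
  define m where "m j = \<mu> (fst j) (Q (fst j) ! snd j)" for j
  define a where "a j = b (fst j) (Q (fst j) ! snd j)" for j
  \<comment> \<open>Different indices may carry the same monomial, so independence applies only
    after collecting their coefficients.\<close>
  define c where "c \<nu> = (\<Sum>j\<in>{j \<in> J. m j = \<nu>}. a j)" for \<nu>
  have J: "finite J" unfolding J_def using fin by blast
  \<comment> \<open>\<open>\<Psi>\<close> is kept arbitrary because both the evaluation at scalars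
    and \<open>\<Phi>\<close> are inserted for it.\<close>
  have reindex: "(\<Sum>w\<in>W. \<Sum>q\<leftarrow>Q w. \<Psi> (\<mu> w q) (b w q)) = (\<Sum>j\<in>J. \<Psi> (m j) (a j))"
    for \<Psi> :: "'x multiset \<Rightarrow> 'v \<Rightarrow> 'z::ab_group_add"
  proof -
    have "(\<Sum>w\<in>W. \<Sum>q\<leftarrow>Q w. \<Psi> (\<mu> w q) (b w q)) =
        (\<Sum>w\<in>W. \<Sum>i=0..<length (Q w). \<Psi> (m (w, i)) (a (w, i)))"
      by (simp add: m_def a_def sum_list_sum_nth)
    then show ?thesis by (simp add: J_def sum.Sigma fin case_prod_unfold)
  qed
  have group: "(\<Sum>j\<in>J. \<Psi> (m j) (a j)) = (\<Sum>\<nu>\<in>m ` J. \<Psi> \<nu> (c \<nu>))"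
    if add': "\<And>\<nu>. additive (\<Psi> \<nu>)" for \<Psi> :: "'x multiset \<Rightarrow> 'v \<Rightarrow> 'z::ab_group_add"
  proof -
    have "(\<Sum>j\<in>J. \<Psi> (m j) (a j)) = (\<Sum>\<nu>\<in>m ` J. \<Sum>j\<in>{j \<in> J. m j = \<nu>}. \<Psi> (m j) (a j))"
      by (rule sum.group[symmetric]) (use J in auto)
    also have "\<dots> = (\<Sum>\<nu>\<in>m ` J. \<Psi> \<nu> (c \<nu>))"
      unfolding c_def by (intro sum.cong refl) (simp add: additive.sum[OF add'])
    finally show ?thesis .
  qed
  have "(\<Sum>\<nu>\<in>m ` J. scale (\<Prod>x\<in>#\<nu>. t x) (c \<nu>)) = 0" for t
    using vanish[of t] reindex[of "\<lambda>\<nu>. scale (\<Prod>x\<in>#\<nu>. t x)"]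
      group[of "\<lambda>\<nu>. scale (\<Prod>x\<in>#\<nu>. t x)"]
    by (simp add: additive.intro scale_right_distrib)
  then have "c \<nu> = 0" if "\<nu> \<in> m ` J" for \<nu>
    using monomials_independent[OF \<open>vector_space scale\<close> _ _ that] J by blast
  moreover have "additive (\<Phi> \<nu>)" for \<nu> by (simp add: additive.intro add)
  ultimately show ?thesis
    using reindex[of \<Phi>] group[of \<Phi>] by (simp add: additive.zero)
qed

section \<open>Identities in coordinates\<close>

lemma eval_word_type: "eval_word ring_of_type_algebra \<sigma> w = prod_list (map \<sigma> w)"
  by (induction w) (simp_all add: eval_word_def ring_of_type_algebra_def)

lemma abelian_monoid_type: "abelian_monoid (ring_of_type_algebra :: 'd::ring_1 ring)"
  by (rule abelian_monoidI) (auto simp: ring_of_type_algebra_def algebra_simps)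

lemma eval_free_type:
  fixes \<sigma> :: "nat \<Rightarrow> 'd::ring_1"
  shows "eval_free ring_of_type_algebra scale \<sigma> f =
    (\<Sum>w\<in>Poly_Mapping.keys f. scale (Poly_Mapping.lookup f w) (prod_list (map \<sigma> w)))"
proof -
  interpret abelian_monoid "ring_of_type_algebra :: 'd ring" by (rule abelian_monoid_type)
  have "finsum ring_of_type_algebra g S = sum g S" if "finite S" for g :: "nat list \<Rightarrow> 'd" and S
    using that
  proof (induction S)
    case empty
    then show ?case unfolding finsum_empty by (simp add: ring_of_type_algebra_def)
  next
    case (insert w S)
    then have "finsum ring_of_type_algebra g (insert w S) =
        g w \<oplus>\<^bsub>ring_of_type_algebra\<^esub> finsum ring_of_type_algebra g S"
      by (intro finsum_insert) (auto simp: ring_of_type_algebra_def)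
    then show ?case using insert unfolding insert.IH by (simp add: ring_of_type_algebra_def)
  qed
  then show ?thesis unfolding eval_free_def eval_word_type by simp
qed

lemma ordinary_identities_type:
  "f \<in> ordinary_identities (ring_of_type_algebra :: 'd::ring_1 ring) scale \<longleftrightarrow>
    (\<forall>\<sigma>. (\<Sum>w\<in>Poly_Mapping.keys f. scale (Poly_Mapping.lookup f w) (prod_list (map \<sigma> w))) = 0)"
  unfolding ordinary_identities_def eval_free_type by (simp add: ring_of_type_algebra_def)

section \<open>Entries of matrix words and identities of matrix algebras\<close>

primrec word_entry ::
  "nat \<Rightarrow> (nat \<Rightarrow> nat \<Rightarrow> nat \<Rightarrow> 'a::semiring_1) \<Rightarrow> nat list \<Rightarrow> nat \<Rightarrow> nat \<Rightarrow> 'a" where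
  "word_entry n \<xi> [] k l = of_bool (k = l)"
| "word_entry n \<xi> (i # w) k l = (\<Sum>p<n. \<xi> i k p * word_entry n \<xi> w p l)"

text \<open>The paths index the monomials in the expansion of a matrix entry; a path keeps the order
  of its factors, its multiset is the commutative monomial in the generic entries.\<close>

primrec word_paths :: "nat \<Rightarrow> nat list \<Rightarrow> nat \<Rightarrow> nat \<Rightarrow> (nat \<times> nat \<times> nat) list list" where
  "word_paths n [] k l = (if k = l then [[]] else [])"
| "word_paths n (i # w) k l =
    concat (map (\<lambda>p. map ((#) (i, k, p)) (word_paths n w p l)) [0..<n])"

lemma sum_list_map_concat:
  fixes g :: "'a \<Rightarrow> 'b::monoid_add"
  shows "sum_list (map g (concat xss)) = (\<Sum>xs\<leftarrow>xss. sum_list (map g xs))"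
  by (induction xss) auto

lemma word_entry_paths:
  "word_entry n \<xi> w k l =
    (\<Sum>q\<leftarrow>word_paths n w k l. prod_list (map (\<lambda>(i, k, p). \<xi> i k p) q))"
proof (induction w arbitrary: k)
  case (Cons i w)
  then show ?case
    by (simp add: sum_list_map_concat o_def sum_list_const_mult interv_sum_list_conv_sum_set_nat
        lessThan_atLeast0)
qed auto

text \<open>This turns matrix identities into scalar polynomial equations in free parameters, the
  form used by \<open>polynomial_identity_transfer\<close>. Values of \<open>\<xi>\<close> outside
  the \<open>n\<close> by \<open>n\<close> block are never read.\<close>

lemma ordinary_identities_mat:
  fixes f :: "'k::field free_algebra"
  shows "f \<in> ordinary_identities (ring_mat TYPE('k) n ()) (\<cdot>\<^sub>m) \<longleftrightarrow>
    (\<forall>\<xi>. \<forall>k<n. \<forall>l<n. (\<Sum>w\<in>Poly_Mapping.keys f. Poly_Mapping.lookup f w * word_entry n \<xi> w k l) = 0)"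
proof -
  let ?R = "ring_mat TYPE('k) n ()"
  interpret R: ring ?R by (rule ring_mat)
  have word: "eval_word ?R \<sigma> w \<in> carrier_mat n n \<and>
      (\<forall>k<n. \<forall>l<n. eval_word ?R \<sigma> w $$ (k, l) = word_entry n (\<lambda>i k l. \<sigma> i $$ (k, l)) w k l)"
    if "\<And>i. \<sigma> i \<in> carrier_mat n n" for \<sigma> w
  proof (induction w)
    case (Cons i w)
    have [simp]: "dim_row (\<sigma> i) = n" "dim_col (\<sigma> i) = n" using that[of i] by auto
    have [simp]: "eval_word ?R \<sigma> (i # w) = \<sigma> i * eval_word ?R \<sigma> w"
      by (simp add: eval_word_def ring_mat_simps)
    from Cons show ?case
      by (auto simp: scalar_prod_def lessThan_atLeast0 intro!: sum.cong)
  qed (auto simp: eval_word_def ring_mat_simps)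
  have sum: "finsum ?R g S \<in> carrier_mat n n \<and>
      (\<forall>k<n. \<forall>l<n. finsum ?R g S $$ (k, l) = (\<Sum>w\<in>S. g w $$ (k, l)))"
    if "finite S" "\<And>w. g w \<in> carrier_mat n n" for g :: "nat list \<Rightarrow> 'k mat" and S
    using that(1)
  proof (induction S)
    case (insert w S)
    have "finsum ?R g (insert w S) = g w + finsum ?R g S"
      using R.finsum_insert[of S w g] insert.hyps that(2) by (auto simp: ring_mat_simps)
    then show ?case using insert that(2)[of w] by auto
  qed (auto simp: ring_mat_simps)
  have free: "eval_free ?R (\<cdot>\<^sub>m) \<sigma> f = 0\<^sub>m n n \<longleftrightarrow> (\<forall>k<n. \<forall>l<n.
      (\<Sum>w\<in>Poly_Mapping.keys f. Poly_Mapping.lookup f w * word_entry n (\<lambda>i k l. \<sigma> i $$ (k, l)) w k l) = 0)"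
    if \<sigma>: "\<And>i. \<sigma> i \<in> carrier_mat n n" for \<sigma>
  proof -
    let ?g = "\<lambda>w. Poly_Mapping.lookup f w \<cdot>\<^sub>m eval_word ?R \<sigma> w"
    have dims: "dim_row (eval_word ?R \<sigma> w) = n" "dim_col (eval_word ?R \<sigma> w) = n" for w
      using word[of \<sigma> w, OF \<sigma>] by auto
    have g: "?g w \<in> carrier_mat n n" for w using dims by auto
    have carr: "eval_free ?R (\<cdot>\<^sub>m) \<sigma> f \<in> carrier_mat n n"
      unfolding eval_free_def using sum[of "Poly_Mapping.keys f" ?g, OF finite_keys g] by blast
    have entry: "eval_free ?R (\<cdot>\<^sub>m) \<sigma> f $$ (k, l) = (\<Sum>w\<in>Poly_Mapping.keys f.
        Poly_Mapping.lookup f w * word_entry n (\<lambda>i k l. \<sigma> i $$ (k, l)) w k l)"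
      if "k < n" "l < n" for k l
    proof -
      have "eval_free ?R (\<cdot>\<^sub>m) \<sigma> f $$ (k, l) = (\<Sum>w\<in>Poly_Mapping.keys f. ?g w $$ (k, l))"
        unfolding eval_free_def
        using sum[of "Poly_Mapping.keys f" ?g, OF finite_keys g] that by blast
      then show ?thesis using that word[of \<sigma>, OF \<sigma>] by (simp add: dims)
    qed
    have "eval_free ?R (\<cdot>\<^sub>m) \<sigma> f = 0\<^sub>m n n \<longleftrightarrow>
        (\<forall>k<n. \<forall>l<n. eval_free ?R (\<cdot>\<^sub>m) \<sigma> f $$ (k, l) = 0)"
      using carr by (auto intro!: eq_matI)
    then show ?thesis using entry by auto
  qed
  have cong: "word_entry n \<xi> w k l = word_entry n (\<lambda>i k l. mat n n (\<lambda>(k, l). \<xi> i k l) $$ (k, l)) w k l"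
    if "k < n" for \<xi> :: "nat \<Rightarrow> nat \<Rightarrow> nat \<Rightarrow> 'k" and w k l
    using that by (induction w arbitrary: k) auto
  show ?thesis
  proof
    assume f: "f \<in> ordinary_identities ?R (\<cdot>\<^sub>m)"
    show "\<forall>\<xi>. \<forall>k<n. \<forall>l<n. (\<Sum>w\<in>Poly_Mapping.keys f. Poly_Mapping.lookup f w * word_entry n \<xi> w k l) = 0"
    proof (intro allI impI)
      fix \<xi> :: "nat \<Rightarrow> nat \<Rightarrow> nat \<Rightarrow> 'k" and k l
      assume "k < n" "l < n"
      moreover have "eval_free ?R (\<cdot>\<^sub>m) (\<lambda>i. mat n n (\<lambda>(k, l). \<xi> i k l)) f = 0\<^sub>m n n"
        using f by (auto simp: ordinary_identities_def ring_mat_simps)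
      ultimately show "(\<Sum>w\<in>Poly_Mapping.keys f. Poly_Mapping.lookup f w * word_entry n \<xi> w k l) = 0"
        using free[of "\<lambda>i. mat n n (\<lambda>(k, l). \<xi> i k l)"] cong[of k \<xi> _ l] by simp
    qed
  qed (auto simp: ordinary_identities_def ring_mat_simps free)
qed

text \<open>
  The generic left multiplications act on the span of the finitely many suffixes of the words of
  \<open>f\<close>; there \<open>f\<close> sends the empty word to the vector of coefficients of \<open>f\<close>.
\<close>

lemma matrix_nonidentity:
  fixes f :: "'k::field free_algebra"
  assumes "f \<noteq> 0"
  obtains N where "N \<ge> 1" and "f \<notin> ordinary_identities (ring_mat TYPE('k) N ()) (\<cdot>\<^sub>m)"
proof -
  define S where "S = (\<Union>w\<in>Poly_Mapping.keys f. set (suffixes w))"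
  have S: "finite S" unfolding S_def by auto
  have tl: "w \<in> S" if "i # w \<in> S" for i w
    using that suffix_ConsD unfolding S_def by fastforce
  obtain v where v: "v \<in> Poly_Mapping.keys f" using assms by (metis all_not_in_conv keys_eq_empty)
  then have vS: "v \<in> S" and NilS: "[] \<in> S" unfolding S_def by auto
  define N where "N = card S"
  obtain b where b: "bij_betw b {..<N} S"
    using ex_bij_betw_nat_finite[OF S] unfolding N_def lessThan_atLeast0 by blast
  have ex: "\<exists>p<N. b p = w" if "w \<in> S" for w
    using that b unfolding bij_betw_def by auto
  have inj: "b p = b q \<longleftrightarrow> p = q" if "p < N" "q < N" for p q
    using that b unfolding bij_betw_def inj_on_def by auto
  \<comment> \<open>\<open>\<xi> i\<close> is the matrix of left multiplication by the variable
    \<open>i\<close> on the span of \<open>S\<close>, words that leave \<open>S\<close> being sent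
    to zero.\<close>
  define \<xi> :: "nat \<Rightarrow> nat \<Rightarrow> nat \<Rightarrow> 'k" where "\<xi> i k l = of_bool (b k = i # b l)" for i k l
  obtain z where z: "z < N" "b z = []" using ex[OF NilS] by blast
  obtain r where r: "r < N" "b r = v" using ex[OF vS] by blast
  have entry: "word_entry N \<xi> w k z = of_bool (b k = w)" if "w \<in> S" "k < N" for w k
    using that
  proof (induction w arbitrary: k)
    case Nil
    then show ?case using inj[of k z] z by simp
  next
    case (Cons i w)
    obtain p where p: "p < N" "b p = w" using ex tl Cons.prems by blast
    have "word_entry N \<xi> (i # w) k z = (\<Sum>q<N. \<xi> i k q * of_bool (q = p))"
    proof -
      have "word_entry N \<xi> w q z = of_bool (q = p)" if "q < N" for q
        using Cons.IH[OF tl[OF Cons.prems(1)] that] inj[OF that p(1)] p(2) by simp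
      then show ?thesis by simp
    qed
    also have "\<dots> = (\<Sum>q\<in>{p}. \<xi> i k q * of_bool (q = p))"
      by (rule sum.mono_neutral_right) (use p in auto)
    also have "\<dots> = \<xi> i k p" by simp
    also have "\<dots> = of_bool (b k = i # w)" by (simp add: \<xi>_def p)
    finally show ?case .
  qed
  have "(\<Sum>w\<in>Poly_Mapping.keys f. Poly_Mapping.lookup f w * word_entry N \<xi> w r z) =
      (\<Sum>w\<in>Poly_Mapping.keys f. Poly_Mapping.lookup f w * of_bool (v = w))"
  proof (intro sum.cong refl)
    fix w assume "w \<in> Poly_Mapping.keys f"
    then have "w \<in> S" unfolding S_def by auto
    then show "Poly_Mapping.lookup f w * word_entry N \<xi> w r z = Poly_Mapping.lookup f w * of_bool (v = w)"
      using entry r by simp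
  qed
  also have "\<dots> = (\<Sum>w\<in>{v}. Poly_Mapping.lookup f w * of_bool (v = w))"
    by (rule sum.mono_neutral_right) (use v in auto)
  also have "\<dots> \<noteq> 0" using v by (simp add: in_keys_iff)
  finally have "f \<notin> ordinary_identities (ring_mat TYPE('k) N ()) (\<cdot>\<^sub>m)"
    unfolding ordinary_identities_mat using r z by blast
  moreover have "N \<ge> 1" using z by simp
  ultimately show thesis using that by blast
qed

section \<open>Graded division algebras\<close>

context graded_algebra
begin

definition part :: "'d \<Rightarrow> 'g \<Rightarrow> 'd" where
  "part x = (THE d. (\<forall>g. d g \<in> component g) \<and> finite {g. d g \<noteq> 0} \<and> x = (\<Sum>g | d g \<noteq> 0. d g))"

lemma part_unique:
  assumes "\<And>g. d g \<in> component g" and "finite {g. d g \<noteq> 0}" and "x = (\<Sum>g | d g \<noteq> 0. d g)"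
  shows "part x = d"
  unfolding part_def by (rule the1_equality[OF direct_sum]) (use assms in blast)

lemma part_in_component: "part x g \<in> component g"
  and finite_part: "finite {g. part x g \<noteq> 0}"
  and sum_part: "(\<Sum>g | part x g \<noteq> 0. part x g) = x"
  using theI'[OF direct_sum[of x], folded part_def] by auto

lemma zero_in_component: "0 \<in> component g"
  using subspace_0[OF subspace_component] .

lemma part_homogeneous:
  assumes "x \<in> component h"
  shows "part x = (\<lambda>g. if g = h then x else 0)"
proof (rule part_unique)
  have "{g. (if g = h then x else 0) \<noteq> 0} \<subseteq> {h}" by auto
  then show "finite {g. (if g = h then x else 0) \<noteq> 0}" by (rule finite_subset) simp
  have "(\<Sum>g | (if g = h then x else 0) \<noteq> 0. if g = h then x else 0) = (\<Sum>g\<in>{h}. if g = h then x else 0)"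
    by (rule sum.mono_neutral_left) auto
  then show "x = (\<Sum>g | (if g = h then x else 0) \<noteq> 0. if g = h then x else 0)" by simp
qed (use assms zero_in_component in auto)

text \<open>Multiplying the decomposition of \<open>y\<close> by \<open>x\<close> and shifting
  degrees by \<open>h\<close> decomposes \<open>x * y\<close>, and decompositions are
  unique.\<close>

lemma part_mult_left:
  assumes "x \<in> component h"
  shows "part (x * y) (h + g) = x * part y g"
proof -
  let ?d = "\<lambda>k. x * part y (k - h)"
  let ?S = "{g. part y g \<noteq> 0}"
  have sub: "{k. ?d k \<noteq> 0} \<subseteq> (+) h ` ?S"
  proof
    fix k assume "k \<in> {k. ?d k \<noteq> 0}"
    then have "k = h + (k - h)" "k - h \<in> ?S" by auto
    then show "k \<in> (+) h ` ?S" by blast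
  qed
  have fin: "finite ((+) h ` ?S)" using finite_part by simp
  have "part (x * y) = ?d"
  proof (rule part_unique)
    show "?d k \<in> component k" for k
      using component_mult[OF assms part_in_component[of y "k - h"]] by simp
    show "finite {k. ?d k \<noteq> 0}" using finite_subset[OF sub fin] .
    have "(\<Sum>k | ?d k \<noteq> 0. ?d k) = (\<Sum>k\<in>(+) h ` ?S. ?d k)"
      by (rule sum.mono_neutral_left) (use sub fin in auto)
    also have "\<dots> = (\<Sum>g\<in>?S. x * part y g)"
      by (subst sum.reindex) auto
    also have "\<dots> = x * y" by (simp add: sum_part flip: sum_distrib_left)
    finally show "x * y = (\<Sum>k | ?d k \<noteq> 0. ?d k)" by simp
  qed
  then show ?thesis by simp
qed

text \<open>Comparing components of degree \<open>h\<close> in \<open>x * 1 = x\<close> shows that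
  \<open>part 1 0\<close> is a right unit for homogeneous elements, hence for all elements, so it
  equals \<open>1\<close>.\<close>

lemma one_in_component: "1 \<in> component 0"
proof -
  have hom: "x * part 1 0 = x" if "x \<in> component h" for x h
    using part_mult_left[OF that, of 1 0] by (simp add: part_homogeneous[OF that])
  have "x * part 1 0 = x" for x
  proof -
    have "x * part 1 0 = (\<Sum>g | part x g \<noteq> 0. part x g * part 1 0)"
      by (simp add: sum_part flip: sum_distrib_right)
    also have "\<dots> = x" by (simp add: hom[OF part_in_component] sum_part)
    finally show ?thesis .
  qed
  from this[of 1] show ?thesis using part_in_component[of 1 0] by simp
qed

end

context graded_division_algebra
begin

text \<open>By the degree \<open>0\<close> part of \<open>x * y = 1\<close>, the component of
  \<open>y\<close> in degree \<open>- h\<close> is a right inverse of \<open>x\<close>; multiplying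
  by \<open>y\<close> on the left identifies it with \<open>y\<close>.\<close>

lemma homogeneous_inverse:
  assumes "x \<in> component h" and "x \<noteq> 0"
  obtains y where "y \<in> component (- h)" and "y * x = 1"
proof -
  obtain y where y: "x * y = 1" "y * x = 1" using homogeneous_invertible assms by blast
  have "x * part y (- h) = part 1 0"
    using part_mult_left[OF assms(1), of y "- h"] y by simp
  then have "y * (x * part y (- h)) = y" by (simp add: part_homogeneous[OF one_in_component])
  then have "part y (- h) = y" by (simp add: y flip: mult.assoc)
  then show thesis using that y part_in_component by metis
qed

text \<open>Zorn's lemma. The last property expresses maximality: a homogeneous element commuting
  with the whole set can be adjoined to it.\<close>

lemma ex_maximal_commuting:
  obtains C where "\<And>c. c \<in> C \<Longrightarrow> \<exists>g. c \<in> component g"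
    and "\<And>c c'. c \<in> C \<Longrightarrow> c' \<in> C \<Longrightarrow> c * c' = c' * c"
    and "\<And>x g. x \<in> component g \<Longrightarrow> (\<And>c. c \<in> C \<Longrightarrow> x * c = c * x) \<Longrightarrow> x \<in> C"
proof -
  define F where "F = {C. C \<subseteq> (\<Union>g. component g) \<and> (\<forall>c\<in>C. \<forall>c'\<in>C. c * c' = c' * c)}"
  have "\<exists>M\<in>F. \<forall>C\<in>F. M \<subseteq> C \<longrightarrow> C = M"
  proof (rule subset_Zorn')
    fix \<C> assume ch: "subset.chain F \<C>"
    have commute: "c * c' = c' * c" if "A \<in> \<C>" "B \<in> \<C>" "c \<in> A" "c' \<in> B" for A B c c'
    proof -
      have "A \<subseteq> B \<or> B \<subseteq> A" "A \<in> F" "B \<in> F"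
        using ch that unfolding subset.chain_def by auto
      then show ?thesis using that unfolding F_def by blast
    qed
    have "A \<subseteq> (\<Union>g. component g)" if "A \<in> \<C>" for A
      using ch that unfolding subset.chain_def F_def by auto
    then have "\<Union>\<C> \<subseteq> (\<Union>g. component g)" by (rule Union_least)
    moreover have "\<forall>c\<in>\<Union>\<C>. \<forall>c'\<in>\<Union>\<C>. c * c' = c' * c" using commute by (meson UnionE)
    ultimately show "\<Union>\<C> \<in> F" unfolding F_def by simp
  qed
  then obtain M where M: "M \<in> F" "\<And>C. C \<in> F \<Longrightarrow> M \<subseteq> C \<Longrightarrow> C = M" by blast
  show thesis
  proof (rule that)
    fix x g assume "x \<in> component g" "\<And>c. c \<in> M \<Longrightarrow> x * c = c * x"
    then have "insert x M \<in> F" using M(1) unfolding F_def by auto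
    then show "x \<in> M" using M(2) by blast
  qed (use M(1) in \<open>auto simp: F_def\<close>)
qed

end

section \<open>Two-sided multiplication operators\<close>

lemma prod_list_commuting:
  fixes xs :: "'a::monoid_mult list"
  assumes "\<And>x y. x \<in> S \<Longrightarrow> y \<in> S \<Longrightarrow> x * y = y * x"
    and "set xs \<subseteq> S" and "mset xs = mset ys"
  shows "prod_list xs = prod_list ys"
  using assms(2,3)
proof (induction xs arbitrary: ys)
  case (Cons x xs)
  then have "x \<in> set ys" by (metis list.set_intros(1) mset_eq_setD)
  then obtain us vs where ys: "ys = us @ x # vs" by (meson split_list)
  have sub: "set ys \<subseteq> S" using Cons.prems mset_eq_setD by blast
  have "prod_list us * x = x * prod_list us"
    using sub Cons.prems(1) unfolding ys
  proof (induction us)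
    case (Cons u us)
    then show ?case using assms(1)[of x u] by simp (metis mult.assoc)
  qed simp
  moreover have "prod_list xs = prod_list (us @ vs)" 
    using Cons.IH[of "us @ vs"] Cons.prems ys by simp
  ultimately show ?case unfolding ys by simp (metis mult.assoc)
qed simp

text \<open>The product is meaningful only for multisets of pairwise commuting elements.\<close>

definition commuting_prod :: "'a::monoid_mult multiset \<Rightarrow> 'a" where
  "commuting_prod \<nu> = prod_list (SOME xs. mset xs = \<nu>)"

lemma commuting_prod_mset:
  assumes "\<And>x y. x \<in> S \<Longrightarrow> y \<in> S \<Longrightarrow> x * y = y * x" and "set xs \<subseteq> S"
  shows "commuting_prod (mset xs) = prod_list xs"
proof -
  have "mset (SOME ys. mset ys = mset xs) = mset xs" by (rule someI[of _ xs]) simp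
  then show ?thesis
    unfolding commuting_prod_def using prod_list_commuting[OF assms] by metis
qed

definition two_sided :: "('d::ring_1 \<times> 'd) list \<Rightarrow> 'd \<Rightarrow> 'd" where
  "two_sided L x = (\<Sum>(a, c)\<leftarrow>L. a * x * c)"

lemma two_sided_Nil [simp]: "two_sided [] x = 0"
  and two_sided_Cons [simp]: "two_sided ((a, c) # L) x = a * x * c + two_sided L x"
  and two_sided_append: "two_sided (L @ L') x = two_sided L x + two_sided L' x"
  by (simp_all add: two_sided_def)

lemma additive_two_sided: "additive (two_sided L)"
proof
  show "two_sided L (x + y) = two_sided L x + two_sided L y" for x y
    by (induction L) (auto simp: algebra_simps)
qed

lemma two_sided_mult_left: "two_sided (map (\<lambda>(a, c). (b * a, c)) L) x = b * two_sided L x"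
  by (induction L) (auto simp: algebra_simps)

lemma two_sided_mult_right: "two_sided (map (\<lambda>(a, c). (a, c * b)) L) x = two_sided L x * b"
  by (induction L) (auto simp: algebra_simps)

text \<open>Composition multiplies left factors in the order of the word and right factors in the
  opposite order; the reversal is harmless once the right factors commute.\<close>

lemma foldr_two_sided:
  "foldr (\<lambda>i. two_sided (L i)) w x =
    (\<Sum>q\<leftarrow>product_lists (map L w). prod_list (map fst q) * x * prod_list (rev (map snd q)))"
proof (induction w)
  case (Cons i w)
  have *: "two_sided M (\<Sum>q\<leftarrow>qs. g q) =
      (\<Sum>p\<leftarrow>M. \<Sum>q\<leftarrow>qs. fst p * g q * snd p)" for M and g :: "('a \<times> 'a) list \<Rightarrow> 'a" and qs
    by (induction M) (auto simp: sum_list_const_mult sum_list_mult_const)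
  show ?case by (simp add: Cons * sum_list_map_concat o_def mult.assoc)
qed simp

section \<open>Operators with right factors in a maximal commuting set\<close>

locale maximal_commuting = graded_division_algebra scale component
  for scale :: "'k::field_char_0 \<Rightarrow> 'd::ring_1 \<Rightarrow> 'd"
    and component :: "'g::ab_group_add \<Rightarrow> 'd set" +
  fixes C :: "'d set"
  assumes C_homogeneous: "c \<in> C \<Longrightarrow> \<exists>g. c \<in> component g"
    and C_commute: "c \<in> C \<Longrightarrow> c' \<in> C \<Longrightarrow> c * c' = c' * c"
    and C_maximal: "x \<in> component g \<Longrightarrow> (\<And>c. c \<in> C \<Longrightarrow> x * c = c * x) \<Longrightarrow> x \<in> C"
begin

lemma one_in_C: "1 \<in> C"
  using C_maximal[OF one_in_component] by simp

lemma mult_in_C: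
  assumes "c \<in> C" "c' \<in> C"
  shows "c * c' \<in> C"
proof -
  obtain g h where "c \<in> component g" "c' \<in> component h" using C_homogeneous assms by metis
  from component_mult[OF this] show ?thesis
  proof (rule C_maximal)
    fix d assume "d \<in> C"
    then show "c * c' * d = d * (c * c')" using C_commute assms by (metis mult.assoc)
  qed
qed

text \<open>Such operators send homogeneous elements to homogeneous ones, so their nonzero values
  there are invertible.\<close>

definition graded_ops :: "'g \<Rightarrow> ('d \<Rightarrow> 'd) set" where
  "graded_ops g = {two_sided L | L. \<forall>(a, c)\<in>set L.
    c \<in> C \<and> (\<exists>h k. a \<in> component h \<and> c \<in> component k \<and> h + k = g)}"

text \<open>Degrees are dropped because the operators that model arbitrary matrices mix
  degrees.\<close>

definition ops :: "('d \<Rightarrow> 'd) set" where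
  "ops = {two_sided L | L. snd ` set L \<subseteq> C}"

lemma graded_ops_ops: "T \<in> graded_ops g \<Longrightarrow> T \<in> ops"
  unfolding graded_ops_def ops_def by fastforce

lemma additive_ops: "T \<in> ops \<Longrightarrow> additive T"
  unfolding ops_def using additive_two_sided by auto

lemma ops_scale: 
  assumes "T \<in> ops"
  shows "T (scale a x) = scale a (T x)"
proof -
  have "two_sided L (scale a x) = scale a (two_sided L x)" for L
    by (induction L) (auto simp: scale_mult_left scale_mult_right scale_right_distrib)
  then show ?thesis using assms unfolding ops_def by auto
qed

lemma ops_zero: "(\<lambda>x. 0) \<in> ops"
proof -
  have "(\<lambda>x. 0) = two_sided []" by auto
  then show ?thesis unfolding ops_def by force
qed

lemma ops_add:
  assumes "T \<in> ops" "U \<in> ops"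
  shows "(\<lambda>x. T x + U x) \<in> ops"
proof -
  obtain L M where "T = two_sided L" "U = two_sided M" "snd ` set L \<subseteq> C" "snd ` set M \<subseteq> C"
    using assms unfolding ops_def by auto
  then have "(\<lambda>x. T x + U x) = two_sided (L @ M)" "snd ` set (L @ M) \<subseteq> C"
    by (auto simp: two_sided_append)
  then show ?thesis unfolding ops_def by blast
qed

lemma ops_sum:
  assumes "finite S" "\<And>i. i \<in> S \<Longrightarrow> T i \<in> ops"
  shows "(\<lambda>x. \<Sum>i\<in>S. T i x) \<in> ops"
  using assms by (induction S) (auto intro: ops_zero ops_add)

lemma ops_mult_left:
  assumes "T \<in> ops"
  shows "(\<lambda>x. b * T x) \<in> ops"
proof -
  obtain L where L: "T = two_sided L" "snd ` set L \<subseteq> C"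
    using assms unfolding ops_def by auto
  let ?M = "map (\<lambda>(a, c). (b * a, c)) L"
  have "(\<lambda>x. b * T x) = two_sided ?M" "snd ` set ?M \<subseteq> C"
    using L by (auto simp: two_sided_mult_left)
  then show ?thesis unfolding ops_def by blast
qed

lemma graded_ops_component:
  assumes "T \<in> graded_ops g" and x: "x \<in> component h"
  shows "T x \<in> component (g + h)"
proof -
  obtain L where T: "T = two_sided L" and L: "\<forall>(a, c)\<in>set L.
      c \<in> C \<and> (\<exists>h k. a \<in> component h \<and> c \<in> component k \<and> h + k = g)"
    using assms(1) unfolding graded_ops_def by blast
  show ?thesis unfolding T using L
  proof (induction L)
    case Nil
    then show ?case by (simp add: zero_in_component)
  next
    case (Cons p L)
    obtain a c where p: "p = (a, c)" by (cases p)
    then obtain k l where kl: "a \<in> component k" "c \<in> component l" "k + l = g"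
      using Cons.prems by auto
    have "a * x * c \<in> component (k + h + l)" using component_mult kl x by blast
    moreover have "k + h + l = g + h" using kl by (simp add: algebra_simps)
    ultimately show ?case
      using Cons subspace_add[OF subspace_component] by (simp add: p)
  qed
qed

lemma graded_ops_id: "(\<lambda>x. x) \<in> graded_ops 0"
proof -
  have "(\<lambda>x. x) = two_sided [(1, 1)]" by auto
  then show ?thesis unfolding graded_ops_def using one_in_C one_in_component by force
qed

lemma graded_ops_zero: "(\<lambda>x. 0) \<in> graded_ops g"
proof -
  have "(\<lambda>x. 0) = two_sided []" by auto
  then show ?thesis unfolding graded_ops_def by force
qed

lemma graded_ops_add:
  assumes "T \<in> graded_ops g" "U \<in> graded_ops g"
  shows "(\<lambda>x. T x + U x) \<in> graded_ops g"
proof -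
  obtain L M where "T = two_sided L" "U = two_sided M"
    "\<forall>(a, c)\<in>set L. c \<in> C \<and> (\<exists>h k. a \<in> component h \<and> c \<in> component k \<and> h + k = g)"
    "\<forall>(a, c)\<in>set M. c \<in> C \<and> (\<exists>h k. a \<in> component h \<and> c \<in> component k \<and> h + k = g)"
    using assms unfolding graded_ops_def by blast
  then have "(\<lambda>x. T x + U x) = two_sided (L @ M)"
    "\<forall>(a, c)\<in>set (L @ M). c \<in> C \<and> (\<exists>h k. a \<in> component h \<and> c \<in> component k \<and> h + k = g)"
    by (auto simp: two_sided_append)
  then show ?thesis unfolding graded_ops_def by blast
qed

lemma graded_ops_sum:
  assumes "finite S" "\<And>i. i \<in> S \<Longrightarrow> T i \<in> graded_ops g"
  shows "(\<lambda>x. \<Sum>i\<in>S. T i x) \<in> graded_ops g"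
  using assms by (induction S) (auto intro: graded_ops_zero graded_ops_add)

lemma graded_ops_mult_left:
  assumes "T \<in> graded_ops g" and b: "b \<in> component h"
  shows "(\<lambda>x. b * T x) \<in> graded_ops (h + g)"
proof -
  obtain L where T: "T = two_sided L" and L: "\<forall>(a, c)\<in>set L.
      c \<in> C \<and> (\<exists>h k. a \<in> component h \<and> c \<in> component k \<and> h + k = g)"
    using assms(1) unfolding graded_ops_def by blast
  let ?M = "map (\<lambda>(a, c). (b * a, c)) L"
  have "(\<lambda>x. b * T x) = two_sided ?M" by (simp add: fun_eq_iff T two_sided_mult_left)
  moreover have "\<forall>(a, c)\<in>set ?M. c \<in> C \<and>
      (\<exists>k l. a \<in> component k \<and> c \<in> component l \<and> k + l = h + g)"
    using L b by (fastforce intro: component_mult simp: add.assoc)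
  ultimately show ?thesis unfolding graded_ops_def by blast
qed

lemma graded_ops_mult_right:
  assumes "T \<in> graded_ops g" and b: "b \<in> component h" "b \<in> C"
  shows "(\<lambda>x. T x * b) \<in> graded_ops (g + h)"
proof -
  obtain L where T: "T = two_sided L" and L: "\<forall>(a, c)\<in>set L.
      c \<in> C \<and> (\<exists>h k. a \<in> component h \<and> c \<in> component k \<and> h + k = g)"
    using assms(1) unfolding graded_ops_def by blast
  let ?M = "map (\<lambda>(a, c). (a, c * b)) L"
  have "(\<lambda>x. T x * b) = two_sided ?M" by (simp add: fun_eq_iff T two_sided_mult_right)
  moreover have "\<forall>(a, c)\<in>set ?M. c \<in> C \<and>
      (\<exists>k l. a \<in> component k \<and> c \<in> component l \<and> k + l = g + h)"
    using L b mult_in_C by (fastforce intro: component_mult simp: add.assoc)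
  ultimately show ?thesis unfolding graded_ops_def by blast
qed

lemma graded_ops_diff:
  assumes "T \<in> graded_ops g" "U \<in> graded_ops g"
  shows "(\<lambda>x. T x - U x) \<in> graded_ops g"
proof -
  have "- 1 \<in> component 0" using subspace_neg[OF subspace_component one_in_component] .
  from graded_ops_add[OF assms(1) graded_ops_mult_left[OF assms(2) this, simplified]]
  show ?thesis by simp
qed

text \<open>The right factors behave like commuting scalars. When each right factor \<open>c\<close>
  is replaced by a scalar \<open>t c\<close>, the operators become left multiplications by elements
  \<open>\<sigma> i\<close>, on which \<open>f\<close> vanishes for every \<open>t\<close>;
  \<open>polynomial_identity_transfer\<close> puts the right factors back.\<close>

lemma identity_ops:
  assumes f: "f \<in> ordinary_identities (ring_of_type_algebra :: 'd ring) scale"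
    and T: "\<And>i. T i \<in> ops"
  shows "(\<Sum>w\<in>Poly_Mapping.keys f. scale (Poly_Mapping.lookup f w) (foldr T w x)) = 0"
proof -
  have "\<forall>i. \<exists>L. T i = two_sided L \<and> snd ` set L \<subseteq> C" using T unfolding ops_def by blast
  then obtain L where L: "\<And>i. T i = two_sided (L i)" "\<And>i. snd ` set (L i) \<subseteq> C" by metis
  let ?Q = "\<lambda>w. product_lists (map L w)"
  have QC: "set (map snd q) \<subseteq> C" if "q \<in> set (?Q w)" for q w
    using that
  proof (induction w arbitrary: q)
    case (Cons i w)
    then show ?case using L(2)[of i] by fastforce
  qed simp
  have "(\<Sum>w\<in>Poly_Mapping.keys f. \<Sum>q\<leftarrow>?Q w.
      (\<lambda>\<nu> b. b * x * commuting_prod \<nu>) (mset (map snd q))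
        (scale (Poly_Mapping.lookup f w) (prod_list (map fst q)))) = 0"
  proof (rule polynomial_identity_transfer[where \<Phi> = "\<lambda>\<nu> b. b * x * commuting_prod \<nu>"
        and \<mu> = "\<lambda>_ q. mset (map snd q)", OF vector_space_axioms finite_keys])
    fix t :: "'d \<Rightarrow> 'k"
    define \<sigma> where "\<sigma> i = (\<Sum>(a, c)\<leftarrow>L i. scale (t c) a)" for i
    have word: "prod_list (map \<sigma> w) =
        (\<Sum>q\<leftarrow>?Q w. scale (\<Prod>c\<in>#mset (map snd q). t c) (prod_list (map fst q)))" for w
    proof (induction w)
      case (Cons i w)
      have *: "(\<Sum>(a, c)\<leftarrow>M. scale (t c) a) * (\<Sum>q\<leftarrow>qs. scale (u q) (g q)) =
          (\<Sum>p\<leftarrow>M. \<Sum>q\<leftarrow>qs. scale (t (snd p) * u q) (fst p * g q))"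
        for M and u :: "('d \<times> 'd) list \<Rightarrow> 'k" and g qs
      proof (induction M)
        case (Cons p M)
        have "scale (t (snd p)) (fst p) * (\<Sum>q\<leftarrow>qs. scale (u q) (g q)) =
            (\<Sum>q\<leftarrow>qs. scale (t (snd p) * u q) (fst p * g q))"
          by (induction qs) (auto simp: distrib_left scale_mult_left scale_mult_right)
        with Cons show ?case by (simp add: case_prod_unfold distrib_right)
      qed simp
      show ?case using Cons by (simp add: \<sigma>_def * sum_list_map_concat o_def)
    qed simp
    have "(\<Sum>w\<in>Poly_Mapping.keys f. scale (Poly_Mapping.lookup f w) (prod_list (map \<sigma> w))) = 0"
      using f unfolding ordinary_identities_type by blast
    moreover have "scale a (\<Sum>q\<leftarrow>qs. scale (u q) (g q)) = (\<Sum>q\<leftarrow>qs. scale (u q) (scale a (g q)))"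
      for a and u :: "('d \<times> 'd) list \<Rightarrow> 'k" and g qs
      by (induction qs) (auto simp: scale_right_distrib mult.commute)
    ultimately show "(\<Sum>w\<in>Poly_Mapping.keys f. \<Sum>q\<leftarrow>?Q w. scale (\<Prod>c\<in>#mset (map snd q). t c)
        (scale (Poly_Mapping.lookup f w) (prod_list (map fst q)))) = 0"
      unfolding word by simp
  qed (simp add: distrib_right)
  moreover have "scale (Poly_Mapping.lookup f w) (foldr T w x) = (\<Sum>q\<leftarrow>?Q w.
      scale (Poly_Mapping.lookup f w) (prod_list (map fst q)) * x * commuting_prod (mset (map snd q)))"
    for w
  proof -
    have "commuting_prod (mset (map snd q)) = prod_list (rev (map snd q))" if "q \<in> set (?Q w)" for q
      using commuting_prod_mset[of C "rev (map snd q)"] QC[OF that] C_commute by simp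
    then have "(\<Sum>q\<leftarrow>?Q w. prod_list (map fst q) * x * commuting_prod (mset (map snd q))) =
        foldr T w x"
      unfolding L(1) foldr_two_sided by (intro arg_cong[of _ _ sum_list] map_cong) auto
    moreover have "(\<Sum>q\<leftarrow>qs. scale a (g q) * x * h q) = scale a (\<Sum>q\<leftarrow>qs. g q * x * h q)"
      for a g h and qs :: "('d \<times> 'd) list list"
      by (induction qs) (auto simp: scale_mult_left scale_right_distrib)
    ultimately show ?thesis by simp
  qed
  ultimately show ?thesis by simp
qed

section \<open>Dual systems and the two inclusions of identities\<close>

definition dual_system ::
  "nat \<Rightarrow> (nat \<Rightarrow> 'g) \<Rightarrow> (nat \<Rightarrow> 'd) \<Rightarrow> (nat \<Rightarrow> 'd \<Rightarrow> 'd) \<Rightarrow> bool" where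
  "dual_system n d v e \<longleftrightarrow>
    (\<forall>i<n. v i \<in> component (d i) \<and> e i \<in> graded_ops (- d i)) \<and>
    (\<forall>i<n. \<forall>j<n. e i (v j) = of_bool (i = j))"

text \<open>The operator identity is evaluated at \<open>v l\<close>. The coordinates of the result
  along the \<open>v p\<close> form column \<open>l\<close> of \<open>f\<close> evaluated at the
  matrices \<open>\<xi>\<close>, and \<open>e k\<close> reads off row \<open>k\<close>.\<close>

lemma dual_system_identities:
  assumes dual: "dual_system n d v e"
    and f: "f \<in> ordinary_identities (ring_of_type_algebra :: 'd ring) scale"
  shows "f \<in> ordinary_identities (ring_mat TYPE('k) n ()) (\<cdot>\<^sub>m)"
  unfolding ordinary_identities_mat
proof (intro allI impI)
  fix \<xi> :: "nat \<Rightarrow> nat \<Rightarrow> nat \<Rightarrow> 'k" and k l assume kl: "k < n" "l < n"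
  have e: "e i \<in> ops" if "i < n" for i
    using dual that graded_ops_ops unfolding dual_system_def by blast
  define T where "T i x = (\<Sum>q<n. (\<Sum>p<n. scale (\<xi> i p q) (v p)) * e q x)" for i x
  have T: "T i \<in> ops" for i
    unfolding T_def by (intro ops_sum ops_mult_left e) auto
  have Tv: "T i (v q) = (\<Sum>p<n. scale (\<xi> i p q) (v p))" if "q < n" for i q
  proof -
    have "T i (v q) = (\<Sum>r<n. (\<Sum>p<n. scale (\<xi> i p r) (v p)) * of_bool (r = q))"
      unfolding T_def using dual that by (auto simp: dual_system_def intro!: sum.cong)
    also have "\<dots> = (\<Sum>r\<in>{q}. (\<Sum>p<n. scale (\<xi> i p r) (v p)) * of_bool (r = q))"
      by (rule sum.mono_neutral_right) (use that in auto)
    finally show ?thesis by simp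
  qed
  have word: "foldr T w (v l) = (\<Sum>p<n. scale (word_entry n \<xi> w p l) (v p))" for w
  proof (induction w)
    case Nil
    have "(\<Sum>p<n. scale (of_bool (p = l)) (v p)) = (\<Sum>p\<in>{l}. scale (of_bool (p = l)) (v p))"
      by (rule sum.mono_neutral_right) (use kl in auto)
    then show ?case by simp
  next
    case (Cons i w)
    have "T i (\<Sum>p<n. scale (word_entry n \<xi> w p l) (v p)) =
        (\<Sum>p<n. \<Sum>q<n. scale (\<xi> i q p * word_entry n \<xi> w p l) (v q))"
      by (simp add: additive.sum[OF additive_ops[OF T]] ops_scale[OF T] Tv scale_sum_right
          mult.commute)
    also have "\<dots> = (\<Sum>q<n. \<Sum>p<n. scale (\<xi> i q p * word_entry n \<xi> w p l) (v q))"
      by (rule sum.swap)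
    finally show ?case using Cons by (simp add: scale_sum_left)
  qed
  define F where "F p = (\<Sum>w\<in>Poly_Mapping.keys f. Poly_Mapping.lookup f w * word_entry n \<xi> w p l)"
    for p
  have "(\<Sum>p<n. scale (F p) (v p)) =
      (\<Sum>w\<in>Poly_Mapping.keys f. scale (Poly_Mapping.lookup f w) (foldr T w (v l)))"
    unfolding word F_def scale_sum_left scale_sum_right by (subst sum.swap) simp
  also have "\<dots> = 0" by (rule identity_ops[OF f T])
  finally have "e k (\<Sum>p<n. scale (F p) (v p)) = 0"
    using additive.zero[OF additive_ops[OF e[OF kl(1)]]] by simp
  moreover have "e k (\<Sum>p<n. scale (F p) (v p)) = (\<Sum>p<n. scale (F p) (of_bool (k = p)))"
    using dual kl(1)
    by (auto simp: additive.sum[OF additive_ops[OF e[OF kl(1)]]] ops_scale[OF e[OF kl(1)]]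
        dual_system_def intro!: sum.cong)
  moreover have "\<dots> = (\<Sum>p\<in>{k}. scale (F p) (of_bool (k = p)))"
    by (rule sum.mono_neutral_right) (use kl in auto)
  ultimately have "scale (F k) 1 = 0" by simp
  then show "(\<Sum>w\<in>Poly_Mapping.keys f. Poly_Mapping.lookup f w * word_entry n \<xi> w k l) = 0"
    by (simp add: F_def)
qed

text \<open>As in the Gram-Schmidt process, \<open>T\<close> is normalized to take the value
  \<open>1\<close> at \<open>x\<close>, which is possible because \<open>T x\<close> is homogeneous
  and nonzero; each \<open>e i\<close> is then corrected to vanish at \<open>x\<close>.\<close>

lemma dual_system_extend:
  assumes dual: "dual_system n d v e" and T: "T \<in> graded_ops g"
    and Tv: "\<And>i. i < n \<Longrightarrow> T (v i) = 0" and x: "x \<in> component h" and Tx: "T x \<noteq> 0"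
  shows "\<exists>d v e. dual_system (Suc n) d v e"
proof -
  obtain y where y: "y \<in> component (- (g + h))" "y * T x = 1"
    using homogeneous_inverse[OF graded_ops_component[OF T x] Tx] .
  define U where "U z = y * T z" for z
  have U: "U \<in> graded_ops (- h)"
    using graded_ops_mult_left[OF T y(1)] unfolding U_def by simp
  have Ux: "U x = 1" and Uv: "\<And>i. i < n \<Longrightarrow> U (v i) = 0"
    using y Tv by (simp_all add: U_def)
  define e' where "e' i = (if i < n then \<lambda>z. e i z - e i x * U z else U)" for i
  have "e' i \<in> graded_ops (- d i)" if "i < n" for i
  proof -
    have ei: "e i \<in> graded_ops (- d i)" using dual that unfolding dual_system_def by blast
    \<comment> \<open>\<open>e i x\<close> has degree \<open>- d i + h\<close> and \<open>U\<close>
      has degree \<open>- h\<close>, so the correction has the degree of \<open>e i\<close>.\<close>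
    from graded_ops_diff[OF ei graded_ops_mult_left[OF U graded_ops_component[OF ei x], simplified]]
    show ?thesis using that by (simp add: e'_def)
  qed
  then have "dual_system (Suc n) (d(n := h)) (v(n := x)) e'"
    using dual U x Ux Uv unfolding dual_system_def
    by (auto simp: less_Suc_eq e'_def)
  then show ?thesis by blast
qed

lemma complete_dual_system_identities:
  assumes dual: "dual_system n d v e"
    and complete: "\<And>T g x h. T \<in> graded_ops g \<Longrightarrow> (\<And>i. i < n \<Longrightarrow> T (v i) = 0) \<Longrightarrow>
      x \<in> component h \<Longrightarrow> T x = 0"
    and f: "f \<in> ordinary_identities (ring_mat TYPE('k) n ()) (\<cdot>\<^sub>m)"
  shows "f \<in> ordinary_identities (ring_of_type_algebra :: 'd ring) scale"
proof -
  have e: "e i \<in> graded_ops (- d i)" and v: "v i \<in> component (d i)" if "i < n" for i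
    using dual that unfolding dual_system_def by auto
  have ev: "e i (v j) = of_bool (i = j)" if "i < n" "j < n" for i j
    using dual that unfolding dual_system_def by blast
  have e_part: "e i x = (\<Sum>g | part x g \<noteq> 0. e i (part x g))" if "i < n" for i x
    using additive.sum[OF additive_ops[OF graded_ops_ops[OF e[OF that]]], of "part x" "{g. part x g \<noteq> 0}"]
    by (simp add: sum_part)
  have kill: "T x = 0" if "T \<in> graded_ops g" "\<And>i. i < n \<Longrightarrow> T (v i) = 0" for T g x
    using additive.sum[OF additive_ops[OF graded_ops_ops[OF that(1)]], of "part x" "{g. part x g \<noteq> 0}"]
      complete[OF that part_in_component]
    by (simp add: sum_part)
  have expand: "(\<Sum>i<n. v i * e i x) = x" for x
  proof -
    \<comment> \<open>The degrees \<open>d i\<close> and \<open>- d i\<close> cancel, so these terms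
      may be subtracted from the identity inside \<open>graded_ops 0\<close>.\<close>
    have "(\<lambda>x. v i * e i x) \<in> graded_ops 0" if "i < n" for i
      using graded_ops_mult_left[OF e[OF that] v[OF that]] by simp
    then have op: "(\<lambda>x. x - (\<Sum>i<n. v i * e i x)) \<in> graded_ops 0"
      by (intro graded_ops_diff graded_ops_id graded_ops_sum) auto
    have "v j - (\<Sum>i<n. v i * e i (v j)) = 0" if "j < n" for j
    proof -
      have "(\<Sum>i<n. v i * e i (v j)) = (\<Sum>i\<in>{j}. v i * e i (v j))"
        by (rule sum.mono_neutral_right) (use that ev in auto)
      then show ?thesis using ev that by simp
    qed
    from kill[OF op this] show ?thesis by simp
  qed
  have commC: "e i x * c = c * e i x" if "c \<in> C" "i < n" for i c x
  proof -
    obtain h where h: "c \<in> component h" using C_homogeneous \<open>c \<in> C\<close> by blast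
    have op: "(\<lambda>x. e i x * c - c * e i x) \<in> graded_ops (- d i + h)"
      using graded_ops_diff[OF graded_ops_mult_right[OF e h \<open>c \<in> C\<close>]
          graded_ops_mult_left[OF e h, unfolded add.commute[of h]]] that by blast
    have "e i (v j) * c - c * e i (v j) = 0" if "j < n" for j
      using ev \<open>i < n\<close> that by simp
    from kill[OF op this] show ?thesis by simp
  qed
  \<comment> \<open>Maximality of \<open>C\<close> applies to homogeneous values only;
    \<open>e_part\<close> carries commutation over to all values.\<close>
  have inC: "e i x \<in> C" if "x \<in> component h" "i < n" for i x h
    using C_maximal[OF graded_ops_component[OF e[OF that(2)] that(1)]] commC that by blast
  have comm: "e i x * e j y = e j y * e i x" if "i < n" "j < n" for i j x y
  proof -
    have "e i x * e j y = (\<Sum>g | part y g \<noteq> 0. e i x * e j (part y g))"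
      using e_part[OF that(2), of y] by (simp add: sum_distrib_left)
    also have "\<dots> = (\<Sum>g | part y g \<noteq> 0. e j (part y g) * e i x)"
      using commC[OF inC[OF part_in_component that(2)] that(1)] by simp
    also have "\<dots> = e j y * e i x"
      using e_part[OF that(2), of y] by (simp add: sum_distrib_right)
    finally show ?thesis .
  qed
  show ?thesis unfolding ordinary_identities_type
  proof
    fix \<sigma> :: "nat \<Rightarrow> 'd"
    \<comment> \<open>By \<open>expand\<close>, this is the matrix of left multiplication by
      \<open>\<sigma> i\<close>, with the coordinates written to the right of the
      \<open>v k\<close>.\<close>
    define \<rho> where "\<rho> i k l = e k (\<sigma> i * v l)" for i k l
    let ?r = "\<lambda>(i, k, l). \<rho> i k l"
    have word: "prod_list (map \<sigma> w) * v l = (\<Sum>k<n. v k * word_entry n \<rho> w k l)"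
      if "l < n" for w l
    proof (induction w)
      case Nil
      have "(\<Sum>k<n. v k * of_bool (k = l)) = (\<Sum>k\<in>{l}. v k * of_bool (k = l))"
        by (rule sum.mono_neutral_right) (use that in auto)
      then show ?case by simp
    next
      case (Cons i w)
      have "prod_list (map \<sigma> (i # w)) * v l = (\<Sum>p<n. \<sigma> i * v p * word_entry n \<rho> w p l)"
        using Cons by (simp add: mult.assoc sum_distrib_left)
      also have "\<dots> = (\<Sum>p<n. \<Sum>k<n. v k * (\<rho> i k p * word_entry n \<rho> w p l))"
      proof (rule sum.cong[OF refl])
        fix p
        have "\<sigma> i * v p * word_entry n \<rho> w p l =
            (\<Sum>k<n. v k * \<rho> i k p) * word_entry n \<rho> w p l"
          unfolding \<rho>_def expand ..
        then show "\<sigma> i * v p * word_entry n \<rho> w p l =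
            (\<Sum>k<n. v k * (\<rho> i k p * word_entry n \<rho> w p l))"
          by (simp add: sum_distrib_right mult.assoc)
      qed
      also have "\<dots> = (\<Sum>k<n. \<Sum>p<n. v k * (\<rho> i k p * word_entry n \<rho> w p l))"
        by (rule sum.swap)
      finally show ?case by (simp add: sum_distrib_left)
    qed
    have entry: "(\<Sum>w\<in>Poly_Mapping.keys f. scale (Poly_Mapping.lookup f w) (word_entry n \<rho> w k l)) = 0"
      if "k < n" "l < n" for k l
    proof -
      \<comment> \<open>The entries of generic scalar matrices are the parameters; the transfer
        substitutes the commuting entries of \<open>\<rho>\<close> for them.\<close>
      have "(\<Sum>w\<in>Poly_Mapping.keys f. \<Sum>q\<leftarrow>word_paths n w k l.
          (\<lambda>\<nu> b. scale b (commuting_prod (image_mset ?r \<nu>))) (mset q) (Poly_Mapping.lookup f w)) = 0"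
      proof (rule polynomial_identity_transfer[where scale = "(*)" and \<mu> = "\<lambda>_ q. mset q"
            and \<Phi> = "\<lambda>\<nu> b. scale b (commuting_prod (image_mset ?r \<nu>))", OF _ finite_keys])
        show "vector_space ((*) :: 'k \<Rightarrow> 'k \<Rightarrow> 'k)"
          by unfold_locales (auto simp: algebra_simps)
        fix t :: "nat \<times> nat \<times> nat \<Rightarrow> 'k"
        have "(\<Sum>w\<in>Poly_Mapping.keys f.
            Poly_Mapping.lookup f w * word_entry n (\<lambda>i k l. t (i, k, l)) w k l) = 0"
          using f that unfolding ordinary_identities_mat by blast
        then show "(\<Sum>w\<in>Poly_Mapping.keys f. \<Sum>q\<leftarrow>word_paths n w k l.
            (\<Prod>x\<in>#mset q. t x) * Poly_Mapping.lookup f w) = 0"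
          by (simp add: word_entry_paths sum_list_const_mult mult.commute prod_mset_prod_list
              flip: mset_map)
      qed (auto simp: scale_left_distrib)
      moreover have "scale (Poly_Mapping.lookup f w) (word_entry n \<rho> w k l) =
          (\<Sum>q\<leftarrow>word_paths n w k l.
            scale (Poly_Mapping.lookup f w) (commuting_prod (image_mset ?r (mset q))))" for w
      proof -
        have "commuting_prod (mset (map ?r q)) = prod_list (map ?r q)"
          if "q \<in> set (word_paths n w k l)" for q
        proof (rule commuting_prod_mset[where S = "{e i x | i x. i < n}"])
          show "x * y = y * x" if "x \<in> {e i x | i x. i < n}" "y \<in> {e i x | i x. i < n}" for x y
            using that comm by blast
          \<comment> \<open>Row indices along a path stay below \<open>n\<close>, so every factor is
            a value of some \<open>e j\<close> with \<open>j < n\<close>, and such values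
            commute.\<close>
          have "j < n" if "q \<in> set (word_paths n w k l)" "(i, j, p) \<in> set q" "k < n" for i j p w k q
            using that by (induction w arbitrary: k q) (auto split: if_splits)
          then show "set (map ?r q) \<subseteq> {e i x | i x. i < n}"
            using that \<open>k < n\<close> unfolding \<rho>_def by fastforce
        qed
        then have "word_entry n \<rho> w k l =
            (\<Sum>q\<leftarrow>word_paths n w k l. commuting_prod (image_mset ?r (mset q)))"
          unfolding word_entry_paths by (intro arg_cong[of _ _ sum_list] map_cong) auto
        moreover have "scale a (\<Sum>q\<leftarrow>qs. g q) = (\<Sum>q\<leftarrow>qs. scale a (g q))"
          for a g and qs :: "(nat \<times> nat \<times> nat) list list"
          by (induction qs) (auto simp: scale_right_distrib)
        ultimately show ?thesis by simp
      qed
      ultimately show ?thesis by simp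
    qed
    let ?F = "\<Sum>w\<in>Poly_Mapping.keys f. scale (Poly_Mapping.lookup f w) (prod_list (map \<sigma> w))"
    have "?F * v l = 0" if "l < n" for l
    proof -
      have "?F * v l = (\<Sum>w\<in>Poly_Mapping.keys f. \<Sum>k<n.
          v k * scale (Poly_Mapping.lookup f w) (word_entry n \<rho> w k l))"
        by (simp add: sum_distrib_right scale_mult_left word[OF that] scale_sum_right
            scale_mult_right)
      also have "\<dots> = (\<Sum>k<n. v k * (\<Sum>w\<in>Poly_Mapping.keys f.
          scale (Poly_Mapping.lookup f w) (word_entry n \<rho> w k l)))"
        by (subst sum.swap) (simp add: sum_distrib_left)
      finally show ?thesis using entry that by simp
    qed
    \<comment> \<open>The \<open>v l * e l 1\<close> sum to \<open>1\<close>, so a left factor that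
      annihilates every \<open>v l\<close> is zero.\<close>
    then have "?F * (\<Sum>l<n. v l * e l 1) = 0"
      by (simp add: sum_distrib_left flip: mult.assoc)
    then show "?F = 0" by (simp add: expand)
  qed
qed

end

section \<open>Choice of the matrix size\<close>

theorem corollary4:
  fixes scale :: "'k::{alg_closed_field, field_char_0} \<Rightarrow> 'd::ring_1 \<Rightarrow> 'd"
    and component :: "'g::ab_group_add \<Rightarrow> 'd set"
  assumes "graded_division_algebra scale component"
    and "\<exists>f \<in> ordinary_identities (ring_of_type_algebra :: 'd ring) scale. f \<noteq> 0"
  shows "\<exists>t::nat. t \<ge> 1 \<and>
    ordinary_identities (ring_of_type_algebra :: 'd ring) scale =
    ordinary_identities (ring_mat TYPE('k) t ()) (\<cdot>\<^sub>m)"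
proof -
  interpret graded_division_algebra scale component by fact
  obtain C where "\<And>c. c \<in> C \<Longrightarrow> \<exists>g. c \<in> component g"
    "\<And>c c'. c \<in> C \<Longrightarrow> c' \<in> C \<Longrightarrow> c * c' = c' * c"
    "\<And>x g. x \<in> component g \<Longrightarrow> (\<And>c. c \<in> C \<Longrightarrow> x * c = c * x) \<Longrightarrow> x \<in> C"
    using ex_maximal_commuting by blast
  then interpret maximal_commuting scale component C by unfold_locales blast+
  obtain f where f: "f \<in> ordinary_identities (ring_of_type_algebra :: 'd ring) scale" "f \<noteq> 0"
    using assms(2) by blast
  obtain N where N: "N \<ge> 1" "f \<notin> ordinary_identities (ring_mat TYPE('k) N ()) (\<cdot>\<^sub>m)"
    using matrix_nonidentity[OF f(2)] .
  let ?P = "\<lambda>n. \<exists>d v e. dual_system n d v e"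
  have one: "dual_system 1 (\<lambda>_. 0) (\<lambda>_. 1) (\<lambda>_ x. x)"
    unfolding dual_system_def using one_in_component graded_ops_id by simp
  have "\<not> ?P N" using dual_system_identities f(1) N(2) by blast
  \<comment> \<open>If each size could be increased, size \<open>N\<close> would be reached from
    \<open>1\<close>; so some size \<open>n\<close> cannot be increased.\<close>
  moreover have "?P N" if "\<And>n. n \<ge> 1 \<Longrightarrow> ?P n \<Longrightarrow> ?P (Suc n)"
    using N(1) by (induction N rule: dec_induct) (use one that in blast)+
  ultimately obtain n where n: "n \<ge> 1" "?P n" "\<not> ?P (Suc n)" by blast
  then obtain d v e where dual: "dual_system n d v e" by blast
  have "ordinary_identities (ring_of_type_algebra :: 'd ring) scale =
      ordinary_identities (ring_mat TYPE('k) n ()) (\<cdot>\<^sub>m)"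
    \<comment> \<open>A homogeneous operator that kills all \<open>v i\<close> but not some
      homogeneous element would give a system of size \<open>Suc n\<close>; this yields the
      completeness hypothesis.\<close>
    using dual_system_identities[OF dual] complete_dual_system_identities[OF dual]
      dual_system_extend[OF dual] n(3) by blast
  with n(1) show ?thesis by blast
qed

end
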